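(* Let $N=1$ and let $B_p(x,t;M)$ be the fundamental solution of the $p$-Laplacian evolution equation $\partial_t u=(|u_x|^{p-2}u_x)_x$ in $\mathbb{R}$ with exponent $p>1$ and mass $M>0$. Then as $p\to1$ we have the singular limit $$\lim_{p\to1}B_p(x,t;M)=(M-2t)_+\,\delta(x)\qquad\text{for all }x\in\mathbb{R},\ t>0,$$ in the sense of measures. In other words, a part of the initial point mass remains frozen at its location but another part escapes to infinity, so that the whole solution vanishes in finite time, $T=M/2$. Moreover, for $\varepsilon=p-1>0$ small we have the uniform estimate $$B_p(x,t;M)\le \Bigl(\frac{2\varepsilon\,t}{|x|^p}\Bigr)^{\frac1{2-p}},$$ which is independent of $M$.
   Context: For $N=1$ and $1<p<2$ the fundamental (Barenblatt) solution with mass $M$, which takes the initial datum $M\delta$, is $B_p(x,t;M)=t^{-\alpha}F_p(x\,t^{-\beta})$ with $\alpha=\beta=\frac1{2(p-1)}$ and $$F_p(y)=\Bigl(C_p+\tfrac{2-p}{p}\,\beta^{\frac1{p-1}}|y|^{\frac p{p-1}}\Bigr)^{-\frac{p-1}{2-p}},$$ where $C_p>0$ is determined by $\int_{\mathbb{R}}B_p(x,t;M)\,dx=M$. Here $\delta$ is the unit Dirac mass at $x=0$ and $(a)_+=\max\{a,0\}$. Since part of the mass escapes to infinity, convergence of measures is understood against continuous compactly supported test functions.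
   Formalization: The displayed estimate fails for large |x| for every p in (1,2); it is proved with 2εt replaced by 2εκt, where κ = (p/(2−p))^ε > 1 is the sharp factor and κ → 1 as p → 1 (x ≠ 0). *)

theory Defs
  imports "HOL-Analysis.Analysis" "HOL-Probability.Giry_Monad"
begin

definition barenblatt_exponent :: "real \<Rightarrow> real" where
  "barenblatt_exponent p = 1 / (2 * (p - 1))"

definition barenblatt_profile :: "real \<Rightarrow> real \<Rightarrow> real \<Rightarrow> real" where
  "barenblatt_profile p C y =
     (C + (2 - p) / p * barenblatt_exponent p powr (1 / (p - 1)) * \<bar>y\<bar> powr (p / (p - 1)))
       powr (- ((p - 1) / (2 - p)))"

definition selfsimilar_solution :: "real \<Rightarrow> real \<Rightarrow> real \<Rightarrow> real \<Rightarrow> real" where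
  "selfsimilar_solution p C x t =
     t powr (- barenblatt_exponent p) * barenblatt_profile p C (x * t powr (- barenblatt_exponent p))"

text \<open>For \<open>1 < p < 2\<close> and \<open>M > 0\<close> the constant below exists and is unique: the mass does not depend
  on \<open>t\<close>, and it is a finite positive multiple of a negative power of \<open>C\<close>.\<close>

definition barenblatt_constant :: "real \<Rightarrow> real \<Rightarrow> real" where
  "barenblatt_constant p M =
     (THE C. C > 0 \<and> (\<forall>t>0. has_bochner_integral lborel (\<lambda>x. selfsimilar_solution p C x t) M))"

text \<open>The fundamental solution, meaningful for \<open>1 < p < 2\<close>, \<open>M > 0\<close>, \<open>t > 0\<close>. Dropping the constant
  from the profile gives, for \<open>x \<noteq> 0\<close>, the upper bound
  \<open>(2 (p - 1) \<kappa> t / \<bar>x\<bar> powr p) powr (1 / (2 - p))\<close> with \<open>\<kappa> = (p / (2 - p)) powr (p - 1) > 1\<close>.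
  The quotient of the two sides tends to 1 as \<open>\<bar>x\<bar> \<rightarrow> \<infinity>\<close>, so \<open>\<kappa>\<close> cannot be replaced by 1 for
  any \<open>p\<close>; it only tends to 1 as \<open>p \<rightarrow> 1\<close>.\<close>

definition barenblatt :: "real \<Rightarrow> real \<Rightarrow> real \<Rightarrow> real \<Rightarrow> real" where
  "barenblatt p M x t = selfsimilar_solution p (barenblatt_constant p M) x t"

definition barenblatt_measure :: "real \<Rightarrow> real \<Rightarrow> real \<Rightarrow> real measure" where
  "barenblatt_measure p M t = density lborel (\<lambda>x. ennreal (barenblatt p M x t))"

text \<open>Convergence is tested on compactly supported functions only, so mass may escape to infinity.\<close>

definition vague_tendsto :: "('i \<Rightarrow> real measure) \<Rightarrow> real measure \<Rightarrow> 'i filter \<Rightarrow> bool" where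
  "vague_tendsto \<mu> \<nu> F \<longleftrightarrow>
     (\<forall>\<phi> :: real \<Rightarrow> real. continuous_on UNIV \<phi> \<and> compact (closure {x. \<phi> x \<noteq> 0}) \<longrightarrow>
        ((\<lambda>i. \<integral>x. \<phi> x \<partial>(\<mu> i)) \<longlongrightarrow> (\<integral>x. \<phi> x \<partial>\<nu>)) F)"

end

theory Submission
  imports Defs "HOL-Real_Asymp.Real_Asymp"
begin

text \<open>
  Write \<open>q = p / (p - 1)\<close> and \<open>g = (p - 1) / (2 - p)\<close>, so that \<open>q g = 1 + 2 g\<close>. Collecting the
  powers of \<open>t\<close> turns the self-similar formula into
  \<open>B x = A * (\<rho> + \<bar>x\<bar> powr q) powr (- g)\<close> with
  \<open>A = (2 (p - 1) (p / (2 - p)) powr (p - 1) t) powr (1 / (2 - p))\<close>,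
  where only \<open>\<rho> > 0\<close> depends on the mass (\<open>selfsimilar_solution_algebraic_form\<close>). Dropping \<open>\<rho>\<close>
  gives the pointwise bound, which is therefore independent of \<open>M\<close>.

  As \<open>p \<rightarrow> 1\<close> one has \<open>q \<rightarrow> \<infinity>\<close>, \<open>g \<rightarrow> 0\<close>, \<open>A \<rightarrow> 0\<close> and \<open>A / g \<rightarrow> 2 t\<close>. The tail
  \<open>A \<bar>x\<bar> powr (- (1 + 2 g))\<close> has mass \<open>(A / g) R powr (- 2 g)\<close> outside \<open>[-R, R]\<close>. This tends to
  \<open>2 t\<close> for every \<open>R\<close>: that much mass can be carried off to infinity, and no more.
  For the mass inside \<open>[-R, R]\<close> this gives the lower bound \<open>M - (A / g) R powr (- 2 g)\<close>, and there
  is a dichotomy for the upper bound, since \<open>\<rho> + \<bar>x\<bar> powr q\<close> behaves like the larger of its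
  two terms.
  If \<open>\<rho> \<ge> R powr q\<close>, the solution is so flat on \<open>[-R, R]\<close> that its mass there is \<open>O(A)\<close>.
  If \<open>\<rho> < R powr q\<close>, the solution is comparable to its tail outside \<open>[-R, R]\<close>, up to
  the factor \<open>2 powr (- g) \<rightarrow> 1\<close>, and the tail carries the mass \<open>2 t\<close>.
  Neither bound involves \<open>\<rho>\<close>, and, the mass being nonnegative, both sides close in on
  \<open>max (M - 2 t) 0\<close> (\<open>inside_mass_bounds\<close>,
  \<open>inside_mass_tendsto\<close>). Since the limit does not depend on \<open>R\<close>, the mass that stays in bounded sets
  concentrates at the origin, which is vague convergence to a multiple of the Dirac mass
  (\<open>vague_tendsto_dirac\<close>).
\<close>

section \<open>Integrals of algebraic profiles on the line\<close>

lemma has_bochner_integral_symmetric_power_tail: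
  fixes a R :: real
  assumes "a > 1" "R > 0"
  shows "has_bochner_integral lborel (\<lambda>x. indicator {x. \<bar>x\<bar> > R} x * \<bar>x\<bar> powr (- a))
           (2 * R powr (1 - a) / (a - 1))"
proof -
  have lim: "((\<lambda>x. x powr (1 - a) / (1 - a)) \<longlongrightarrow> 0) at_top"
    using assms by real_asymp
  have deriv: "((\<lambda>x. x powr (1 - a) / (1 - a)) has_real_derivative x powr (- a)) (at x)" if "x > 0" for x
    using DERIV_cdivide[OF has_real_derivative_powr[OF that, of "1 - a"], of "1 - a"] assms by simp
  have "(\<integral>\<^sup>+x. ennreal (x powr (- a)) * indicator {R..} x \<partial>lborel)
          = ennreal (0 - R powr (1 - a) / (1 - a))"
    using assms by (intro nn_integral_FTC_atLeast[OF _ deriv _ lim]) auto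
  also have "0 - R powr (1 - a) / (1 - a) = R powr (1 - a) / (a - 1)"
    using assms by (simp add: field_simps)
  finally have "(\<integral>\<^sup>+x. ennreal (x powr (- a)) * indicator {R..} x \<partial>lborel) = \<dots>" .
  then have "(\<integral>\<^sup>+x. ennreal (indicator {R..} x * x powr (- a)) \<partial>lborel)
          = ennreal (R powr (1 - a) / (a - 1))"
    by (subst nn_integral_cong[where v = "\<lambda>x. ennreal (x powr (- a)) * indicator {R..} x"]) (auto simp: indicator_def)
  then have half: "has_bochner_integral lborel (\<lambda>x. indicator {R..} x * x powr (- a)) (R powr (1 - a) / (a - 1))"
    using assms by (intro has_bochner_integral_nn_integral) auto
  from half have half': "has_bochner_integral lborel (\<lambda>x. indicator {R..} (- x) * (- x) powr (- a)) (R powr (1 - a) / (a - 1))"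
    using lborel_has_bochner_integral_real_affine_iff[of "- 1" "\<lambda>x. indicator {R..} x * x powr (- a)" _ 0] by simp
  have ae: "AE x in lborel. x \<noteq> R \<and> x \<noteq> - R"
    by (intro AE_conjI AE_lborel_singleton)
  have "has_bochner_integral lborel (\<lambda>x. indicator {R..} x * x powr (- a) + indicator {R..} (- x) * (- x) powr (- a))
          (2 * R powr (1 - a) / (a - 1))"
    using has_bochner_integral_add[OF half half'] by simp
  then show ?thesis
  proof (rule has_bochner_integralI_AE)
    show "AE x in lborel. indicator {R..} x * x powr (- a) + indicator {R..} (- x) * (- x) powr (- a)
            = indicator {x. \<bar>x\<bar> > R} x * \<bar>x\<bar> powr (- a)"
      using ae by eventually_elim (use assms in \<open>auto simp: indicator_def\<close>)
  qed simp
qed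

lemma has_bochner_integral_le:
  fixes f g :: "'a \<Rightarrow> real"
  assumes "has_bochner_integral M f I" "has_bochner_integral M g J" "\<And>x. f x \<le> g x"
  shows "I \<le> J"
  using assms integral_mono[of M f g] by (auto simp: has_bochner_integral_iff)

lemma has_bochner_integral_indicator_symmetric_interval:
  fixes R :: real
  assumes "R \<ge> 0"
  shows "has_bochner_integral lborel (\<lambda>x. indicator {x. \<bar>x\<bar> \<le> R} x * c) (2 * R * c :: real)"
proof -
  have *: "{x. \<bar>x\<bar> \<le> R} = {- R..R}" by auto
  have "has_bochner_integral lborel (indicator {- R..R}) (measure lborel {- R..R})"
    by (intro has_bochner_integral_real_indicator) (auto simp: emeasure_lborel_Icc_eq)
  then show ?thesis
    using assms unfolding * by (auto dest!: has_bochner_integral_mult_left[where c=c])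
qed

text \<open>The outside mass is at most that of the pure power \<open>A \<bar>x\<bar> powr (- (1 + 2 g))\<close>, which
  yields the lower bound. The upper bound is a maximum because either \<open>\<rho>\<close> dominates
  \<open>\<bar>x\<bar> powr q\<close> on the whole ball, which bounds the inside mass directly, or \<open>\<bar>x\<bar> powr q\<close>
  dominates \<open>\<rho>\<close> on the whole complement, which bounds the outside mass from below. Neither
  bound involves \<open>\<rho>\<close>, so both pass to the limit without control of \<open>\<rho>\<close>.\<close>

lemma inside_mass_bounds:
  fixes B :: "real \<Rightarrow> real" and A \<rho> q g M R :: real
  assumes B: "\<And>x. B x = A * (\<rho> + \<bar>x\<bar> powr q) powr (- g)"
    and mass: "has_bochner_integral lborel B M"
    and pos: "A > 0" "\<rho> > 0" "g > 0" "R > 0" "q > 0" and q: "q * g = 1 + 2 * g"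
  shows "M - A / g * R powr (- (2 * g)) \<le> (\<integral>x. indicator {x. \<bar>x\<bar> \<le> R} x * B x \<partial>lborel)" (is ?lower)
    and "(\<integral>x. indicator {x. \<bar>x\<bar> \<le> R} x * B x \<partial>lborel)
           \<le> max (2 * A * R powr (- (2 * g))) (M - 2 powr (- g) * (A / g * R powr (- (2 * g))))" (is ?upper)
proof -
  define I where "I = (\<integral>x. indicator {x. \<bar>x\<bar> \<le> R} x * B x \<partial>lborel)"
  have nonneg: "B x \<ge> 0" for x using B pos by simp
  have intB: "integrable lborel B" using mass by (simp add: has_bochner_integral_iff)
  have ms: "{x::real. \<bar>x\<bar> \<le> R} \<in> sets lborel" by simp
  have int_inside: "integrable lborel (\<lambda>x. indicator {x. \<bar>x\<bar> \<le> R} x * B x)"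
    using integrable_real_mult_indicator[OF ms intB] by (simp add: mult.commute)
  then have inner: "has_bochner_integral lborel (\<lambda>x. indicator {x. \<bar>x\<bar> \<le> R} x * B x) I"
    by (simp add: has_bochner_integral_iff I_def)
  have outer: "has_bochner_integral lborel (\<lambda>x. indicator {x. \<bar>x\<bar> > R} x * B x) (M - I)"
    using has_bochner_integral_diff[OF mass inner]
    by (rule has_bochner_integral_cong[THEN iffD1, rotated -1]) (auto simp: indicator_def)
  have powq: "(\<bar>x\<bar> powr q) powr (- g) = \<bar>x\<bar> powr (- (1 + 2 * g))" for x
    by (simp add: powr_powr q[symmetric])
  have tail: "has_bochner_integral lborel
      (\<lambda>x. c * A * (indicator {x. \<bar>x\<bar> > R} x * \<bar>x\<bar> powr (- (1 + 2 * g)))) (c * (A / g * R powr (- (2 * g))))" for c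
    using has_bochner_integral_mult_right[OF has_bochner_integral_symmetric_power_tail[of "1 + 2 * g" R], of "c * A"] pos
    by (simp add: mult.assoc)
  have "M - I \<le> 1 * (A / g * R powr (- (2 * g)))"
  proof (rule has_bochner_integral_le[OF outer tail])
    fix x :: real
    have "(\<rho> + \<bar>x\<bar> powr q) powr (- g) \<le> (\<bar>x\<bar> powr q) powr (- g)" if "\<bar>x\<bar> > R"
      using pos that by (intro powr_mono2') auto
    then show "indicator {x. \<bar>x\<bar> > R} x * B x \<le> 1 * A * (indicator {x. \<bar>x\<bar> > R} x * \<bar>x\<bar> powr (- (1 + 2 * g)))"
      using pos by (auto simp: B powq indicator_def)
  qed
  then show ?lower by (simp add: I_def)
  show ?upper
  proof (cases "\<rho> \<ge> R powr q")
    case True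
    have "I \<le> 2 * R * (A * R powr (- (1 + 2 * g)))"
    proof (rule has_bochner_integral_le[OF inner has_bochner_integral_indicator_symmetric_interval])
      fix x :: real
      have "(\<rho> + \<bar>x\<bar> powr q) powr (- g) \<le> (R powr q) powr (- g)"
        using pos True by (intro powr_mono2') (auto intro: add_increasing2)
      also have "\<dots> = R powr (- (1 + 2 * g))" using powq[of R] pos by simp
      finally show "indicator {x. \<bar>x\<bar> \<le> R} x * B x \<le> indicator {x. \<bar>x\<bar> \<le> R} x * (A * R powr (- (1 + 2 * g)))"
        using pos by (auto simp: B indicator_def)
    qed (use pos in auto)
    also have "R powr (- (1 + 2 * g)) = R powr (- (2 * g)) / R"
    proof -
      have "- (1 + 2 * g) = - (2 * g) - 1" by simp
      then show ?thesis using pos by (simp only: powr_diff powr_one)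
    qed
    finally show ?thesis using pos by (simp add: I_def)
  next
    case False
    have "2 powr (- g) * (A / g * R powr (- (2 * g))) \<le> M - I"
    proof (rule has_bochner_integral_le[OF tail outer])
      fix x :: real
      have "2 powr (- g) * \<bar>x\<bar> powr (- (1 + 2 * g)) \<le> (\<rho> + \<bar>x\<bar> powr q) powr (- g)" if x: "\<bar>x\<bar> > R"
      proof -
        have "R powr q \<le> \<bar>x\<bar> powr q" using pos x by (intro powr_mono2) auto
        then have "(2 * \<bar>x\<bar> powr q) powr (- g) \<le> (\<rho> + \<bar>x\<bar> powr q) powr (- g)"
          using pos False by (intro powr_mono2') (auto intro: add_pos_nonneg)
        then show ?thesis by (simp add: powr_mult powq)
      qed
      then show "2 powr (- g) * A * (indicator {x. \<bar>x\<bar> > R} x * \<bar>x\<bar> powr (- (1 + 2 * g))) \<le> indicator {x. \<bar>x\<bar> > R} x * B x"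
        using pos by (auto simp: B indicator_def mult.assoc mult.left_commute)
    qed
    then show ?thesis by (simp add: I_def)
  qed
qed

lemma standard_profile_integrable:
  fixes q g :: real
  assumes "g > 0" "q > 0" "q * g > 1"
  shows "integrable lborel (\<lambda>z. (1 + \<bar>z\<bar> powr q) powr (- g))"
    and "(\<integral>z. (1 + \<bar>z\<bar> powr q) powr (- g) \<partial>lborel) > 0"
proof -
  define G where "G z = (1 + \<bar>z\<bar> powr q) powr (- g)" for z :: real
  have core: "integrable lborel (\<lambda>z::real. indicator {x. \<bar>x\<bar> \<le> 1} z * (1::real))"
    using has_bochner_integral_indicator_symmetric_interval[of 1 1] by (simp add: has_bochner_integral_iff)
  have tail: "integrable lborel (\<lambda>z::real. indicator {x. \<bar>x\<bar> > 1} z * \<bar>z\<bar> powr (- (q * g)))"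
    using has_bochner_integral_symmetric_power_tail[of "q * g" 1] assms by (simp add: has_bochner_integral_iff)
  show int: "integrable lborel (\<lambda>z. (1 + \<bar>z\<bar> powr q) powr (- g))"
  proof (rule Bochner_Integration.integrable_bound[OF Bochner_Integration.integrable_add[OF core tail]], measurable, intro AE_I2)
    fix z :: real
    have "(1 + \<bar>z\<bar> powr q) powr (- g) \<le> 1 powr (- g)"
      using assms by (intro powr_mono2') auto
    moreover have "(1 + \<bar>z\<bar> powr q) powr (- g) \<le> (\<bar>z\<bar> powr q) powr (- g)" if "z \<noteq> 0"
      using assms that by (intro powr_mono2') auto
    ultimately show "norm ((1 + \<bar>z\<bar> powr q) powr (- g))
      \<le> norm (indicator {x. \<bar>x\<bar> \<le> 1} z * 1 + indicator {x. \<bar>x\<bar> > 1} z * \<bar>z\<bar> powr (- (q * g)))"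
      by (cases "\<bar>z\<bar> \<le> 1") (auto simp: powr_powr)
  qed
  have "2 * 1 * 2 powr (- g) \<le> (\<integral>z. (1 + \<bar>z\<bar> powr q) powr (- g) \<partial>lborel)"
  proof (rule has_bochner_integral_le[OF has_bochner_integral_indicator_symmetric_interval])
    fix z :: real
    have "2 powr (- g) \<le> (1 + \<bar>z\<bar> powr q) powr (- g)" if "\<bar>z\<bar> \<le> 1"
      using assms that powr_mono2[of q "\<bar>z\<bar>" 1] by (intro powr_mono2') (auto intro: add_pos_nonneg)
    then show "indicator {x. \<bar>x\<bar> \<le> 1} z * 2 powr (- g) \<le> (1 + \<bar>z\<bar> powr q) powr (- g)"
      by (auto simp: indicator_def)
  qed (use int in \<open>auto simp: has_bochner_integral_iff\<close>)
  then show "(\<integral>z. (1 + \<bar>z\<bar> powr q) powr (- g) \<partial>lborel) > 0"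
    using powr_gt_zero[of 2 "- g"] by linarith
qed

section \<open>The normalising constant\<close>

lemma has_bochner_integral_dilation:
  fixes f :: "real \<Rightarrow> real"
  assumes "has_bochner_integral lborel f I" "c > 0"
  shows "has_bochner_integral lborel (\<lambda>x. f (x * c)) (I / c)"
  using assms lborel_has_bochner_integral_real_affine_iff[of c f I 0] by (simp add: mult.commute divide_inverse)

text \<open>Two dilations reduce every profile to \<open>(1 + \<bar>z\<bar> powr q) powr (- g)\<close>: the one by
  \<open>t powr (- \<beta>)\<close> preserves mass, the one that normalises \<open>C\<close> contributes a power of \<open>C\<close>.
  Its exponent is \<open>e = 1 / q - g\<close>, and \<open>e \<noteq> 0\<close> makes the mass an injective function of \<open>C\<close>.\<close>

lemma selfsimilar_mass:
  fixes p :: real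
  assumes "1 < p" "p < 2"
  shows "\<exists>e J. e \<noteq> 0 \<and> J > 0 \<and> (\<forall>C>0. \<forall>t>0.
    has_bochner_integral lborel (\<lambda>x. selfsimilar_solution p C x t) (J * C powr e))"
proof -
  define q where "q = p / (p - 1)"
  define g where "g = (p - 1) / (2 - p)"
  define b where "b = barenblatt_exponent p"
  define K where "K = (2 - p) / p * b powr (1 / (p - 1))"
  define J0 where "J0 = (\<integral>z. (1 + \<bar>z\<bar> powr q) powr (- g) \<partial>lborel)"
  have pos: "q > 0" "g > 0" "b > 0" "K > 0" "q * g > 1"
    using assms by (auto simp: q_def g_def b_def K_def barenblatt_exponent_def)
  note std = standard_profile_integrable[OF pos(2,1,5)]
  have std_mass: "has_bochner_integral lborel (\<lambda>z. (1 + \<bar>z\<bar> powr q) powr (- g)) J0"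
    using std by (simp add: J0_def has_bochner_integral_iff)
  have "has_bochner_integral lborel (\<lambda>x. selfsimilar_solution p C x t) (J0 * K powr (- (1 / q)) * C powr (1 / q - g))"
    if C: "C > 0" and t: "t > 0" for C t
  proof -
    have eq: "barenblatt_profile p C y = C powr (- g) * (1 + \<bar>y * (K / C) powr (1 / q)\<bar> powr q) powr (- g)" for y
    proof -
      have "\<bar>y * (K / C) powr (1 / q)\<bar> powr q = \<bar>y\<bar> powr q * (K / C)"
        using pos C by (simp add: abs_mult powr_mult powr_powr)
      then have *: "C + K * \<bar>y\<bar> powr q = C * (1 + \<bar>y * (K / C) powr (1 / q)\<bar> powr q)"
        using C by (simp add: field_simps)
      have "barenblatt_profile p C y = (C + K * \<bar>y\<bar> powr q) powr (- g)"
        by (simp add: barenblatt_profile_def K_def b_def q_def g_def)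
      then show ?thesis unfolding * using C by (simp add: powr_mult)
    qed
    have "has_bochner_integral lborel (barenblatt_profile p C) (C powr (- g) * (J0 / (K / C) powr (1 / q)))"
      unfolding eq[abs_def]
      by (intro has_bochner_integral_mult_right has_bochner_integral_dilation[OF std_mass]) (use pos C in auto)
    also have "C powr (- g) * (J0 / (K / C) powr (1 / q)) = J0 * K powr (- (1 / q)) * C powr (1 / q - g)"
      unfolding powr_divide powr_diff powr_minus by (simp add: divide_inverse ac_simps)
    finally have "has_bochner_integral lborel (\<lambda>x. t powr (- b) * barenblatt_profile p C (x * t powr (- b)))
       (t powr (- b) * (J0 * K powr (- (1 / q)) * C powr (1 / q - g) / t powr (- b)))"
      by (intro has_bochner_integral_mult_right has_bochner_integral_dilation) (use t in auto)
    then show ?thesis using t by (simp add: selfsimilar_solution_def b_def)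
  qed
  moreover have "1 / q - g \<noteq> 0" using pos by (auto simp: field_simps)
  moreover have "J0 * K powr (- (1 / q)) > 0" using std pos by (simp add: J0_def)
  ultimately show ?thesis by blast
qed

lemma barenblatt_constant_spec:
  fixes p M :: real
  assumes "1 < p" "p < 2" "M > 0"
  shows "barenblatt_constant p M > 0"
    and "t > 0 \<Longrightarrow> has_bochner_integral lborel (\<lambda>x. barenblatt p M x t) M"
proof -
  obtain e J where e: "e \<noteq> 0" "J > 0" and mass: "\<And>C t. C > 0 \<Longrightarrow> t > 0 \<Longrightarrow>
    has_bochner_integral lborel (\<lambda>x. selfsimilar_solution p C x t) (J * C powr e)"
    using selfsimilar_mass[OF assms(1,2)] by blast
  let ?P = "\<lambda>C. C > 0 \<and> (\<forall>t>0. has_bochner_integral lborel (\<lambda>x. selfsimilar_solution p C x t) M)"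
  have P: "?P C \<longleftrightarrow> C = (M / J) powr (1 / e)" for C
  proof
    assume C: "?P C"
    then have "J * C powr e = M"
      using has_bochner_integral_eq[OF mass[of C 1], of M] by simp
    then have "C powr e = M / J" using e by (simp add: field_simps)
    then have "(C powr e) powr (1 / e) = (M / J) powr (1 / e)" by simp
    then show "C = (M / J) powr (1 / e)" using C e by (simp add: powr_powr)
  next
    assume C: "C = (M / J) powr (1 / e)"
    then have "C > 0" "J * C powr e = M" using assms e by (auto simp: powr_powr)
    then show "?P C" using mass[of C] by auto
  qed
  have "?P (barenblatt_constant p M)"
    unfolding barenblatt_constant_def P by simp
  then show "barenblatt_constant p M > 0"
    and "t > 0 \<Longrightarrow> has_bochner_integral lborel (\<lambda>x. barenblatt p M x t) M"
    by (auto simp: barenblatt_def)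
qed

section \<open>The solution as a regularised power\<close>

text \<open>The coefficient of \<open>\<bar>x\<bar> powr (- p / (2 - p))\<close> in the solution with \<open>C = 0\<close>. It is
  the limit of \<open>B \<bar>x\<bar> powr (p / (2 - p))\<close> as \<open>\<bar>x\<bar> \<rightarrow> \<infinity>\<close>, whatever the mass.\<close>

definition tail_coefficient :: "real \<Rightarrow> real \<Rightarrow> real" where
  "tail_coefficient p t = (2 * (p - 1) * (p / (2 - p)) powr (p - 1) * t) powr (1 / (2 - p))"

text \<open>With \<open>K\<close> the coefficient of \<open>\<bar>y\<bar> powr q\<close> in the profile, factoring
  \<open>K t powr (- \<beta> q)\<close> out of the bracket leaves \<open>\<rho> = C t powr (\<beta> q) / K\<close>. The prefactor is
  free of \<open>C\<close>, and its power of \<open>t\<close> is \<open>\<beta> (q g - 1) = 1 / (2 - p)\<close>.\<close>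

lemma selfsimilar_solution_algebraic_form:
  fixes p C t :: real
  assumes "1 < p" "p < 2" "C > 0" "t > 0"
  obtains \<rho> where "\<rho> > 0" "\<And>x. selfsimilar_solution p C x t
    = tail_coefficient p t * (\<rho> + \<bar>x\<bar> powr (p / (p - 1))) powr (- ((p - 1) / (2 - p)))"
proof -
  define q where "q = p / (p - 1)"
  define g where "g = (p - 1) / (2 - p)"
  define b where "b = barenblatt_exponent p"
  define K where "K = (2 - p) / p * b powr (1 / (p - 1))"
  define \<rho> where "\<rho> = C * t powr (b * q) / K"
  have pos: "q > 0" "g > 0" "b > 0" "K > 0" 
    using assms by (auto simp: q_def g_def b_def K_def barenblatt_exponent_def)
  have tpos: "tail_coefficient p t > 0"
    using assms by (simp add: tail_coefficient_def)
  have lnb: "ln b = - ln (2 * (p - 1))"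
    using assms by (simp add: b_def barenblatt_exponent_def ln_div)
  have lnK: "ln K = ln (2 - p) - ln p - ln (2 * (p - 1)) / (p - 1)"
    using assms pos by (simp add: K_def ln_mult ln_div ln_powr lnb)
  have lnA: "ln (tail_coefficient p t) = (ln (2 * (p - 1)) + (p - 1) * (ln p - ln (2 - p)) + ln t) / (2 - p)"
    using assms by (simp add: tail_coefficient_def ln_powr ln_mult ln_div)
  \<comment> \<open>The prefactor is a product of powers, so the identity is linear in logarithms.\<close>
  have "- b * ln t - g * (ln K - b * q * ln t) = ln (tail_coefficient p t)"
    unfolding lnA lnK using assms
    by (simp add: b_def g_def q_def barenblatt_exponent_def divide_simps, simp add: algebra_simps)
  then have "ln (t powr (- b) * (K * t powr (- (b * q))) powr (- g)) = ln (tail_coefficient p t)"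
    using assms pos by (simp add: ln_mult ln_powr algebra_simps)
  then have coeff: "t powr (- b) * (K * t powr (- (b * q))) powr (- g) = tail_coefficient p t"
    using assms pos tpos by (subst (asm) ln_inj_iff) auto
  have "selfsimilar_solution p C x t = tail_coefficient p t * (\<rho> + \<bar>x\<bar> powr q) powr (- g)" for x
  proof -
    have "\<bar>x * t powr (- b)\<bar> powr q = \<bar>x\<bar> powr q * t powr (- (b * q))"
      by (simp add: abs_mult powr_mult powr_powr)
    then have "C + K * \<bar>x * t powr (- b)\<bar> powr q = K * t powr (- (b * q)) * (\<rho> + \<bar>x\<bar> powr q)"
      using assms pos by (simp add: \<rho>_def powr_minus field_simps)
    then have "selfsimilar_solution p C x t = t powr (- b) * (K * t powr (- (b * q)) * (\<rho> + \<bar>x\<bar> powr q)) powr (- g)"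
      by (simp add: selfsimilar_solution_def barenblatt_profile_def K_def b_def q_def g_def)
    also have "\<dots> = t powr (- b) * (K * t powr (- (b * q))) powr (- g) * (\<rho> + \<bar>x\<bar> powr q) powr (- g)"
      using pos assms by (simp add: powr_mult mult.assoc)
    finally show ?thesis unfolding coeff .
  qed
  moreover have "\<rho> > 0" using assms pos by (simp add: \<rho>_def)
  ultimately show thesis using that by (auto simp: q_def g_def)
qed

lemma barenblatt_algebraic_form:
  fixes p M t :: real
  assumes "1 < p" "p < 2" "M > 0" "t > 0"
  obtains \<rho> where "\<rho> > 0" "\<And>x. barenblatt p M x t
    = tail_coefficient p t * (\<rho> + \<bar>x\<bar> powr (p / (p - 1))) powr (- ((p - 1) / (2 - p)))"
  using selfsimilar_solution_algebraic_form[OF assms(1,2) barenblatt_constant_spec(1)[OF assms(1,2,3)] assms(4)]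
  unfolding barenblatt_def by blast

lemma tail_coefficient_pos: "1 < p \<Longrightarrow> p < 2 \<Longrightarrow> t > 0 \<Longrightarrow> tail_coefficient p t > 0"
  by (simp add: tail_coefficient_def)

lemma barenblatt_upper_bound:
  fixes p M t x :: real
  assumes "1 < p" "p < 2" "M > 0" "t > 0" "x \<noteq> 0"
  shows "barenblatt p M x t
    \<le> (2 * (p - 1) * (p / (2 - p)) powr (p - 1) * t / \<bar>x\<bar> powr p) powr (1 / (2 - p))"
proof -
  obtain \<rho> where \<rho>: "\<rho> > 0" and form: "\<And>x. barenblatt p M x t
    = tail_coefficient p t * (\<rho> + \<bar>x\<bar> powr (p / (p - 1))) powr (- ((p - 1) / (2 - p)))"
    using barenblatt_algebraic_form[OF assms(1-4)] by blast
  have "(\<rho> + \<bar>x\<bar> powr (p / (p - 1))) powr (- ((p - 1) / (2 - p)))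
      \<le> (\<bar>x\<bar> powr (p / (p - 1))) powr (- ((p - 1) / (2 - p)))"
    using assms \<rho> by (intro powr_mono2') auto
  also have "\<dots> = 1 / (\<bar>x\<bar> powr p) powr (1 / (2 - p))"
    using assms by (simp add: powr_powr powr_minus_divide)
  finally have "barenblatt p M x t \<le> tail_coefficient p t * (1 / (\<bar>x\<bar> powr p) powr (1 / (2 - p)))"
    unfolding form using tail_coefficient_pos[OF assms(1,2,4)] by (intro mult_left_mono) auto
  also have "\<dots> = (2 * (p - 1) * (p / (2 - p)) powr (p - 1) * t / \<bar>x\<bar> powr p) powr (1 / (2 - p))"
    unfolding tail_coefficient_def by (subst powr_divide) simp
  finally show ?thesis .
qed

section \<open>The mass in a ball\<close>

lemma measure_density_real:
  fixes f :: "'a \<Rightarrow> real"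
  assumes "integrable N f" "\<And>x. f x \<ge> 0" "S \<in> sets N"
  shows "measure (density N f) S = (\<integral>x. indicator S x * f x \<partial>N)"
proof -
  have int: "integrable N (\<lambda>x. indicator S x * f x)"
    using integrable_real_mult_indicator[OF assms(3,1)] by (simp add: mult.commute)
  have "emeasure (density N f) S = (\<integral>\<^sup>+x. ennreal (indicator S x * f x) \<partial>N)"
    using assms by (subst emeasure_density) (auto simp: indicator_def intro!: nn_integral_cong)
  also have "\<dots> = ennreal (\<integral>x. indicator S x * f x \<partial>N)"
    using int assms by (intro nn_integral_eq_integral) auto
  finally show ?thesis
    using assms by (simp add: measure_def)
qed

lemma barenblatt_measure_facts:
  fixes p M t :: real
  assumes "1 < p" "p < 2" "M > 0" "t > 0"
  shows "sets (barenblatt_measure p M t) = sets borel"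
    and "finite_measure (barenblatt_measure p M t)"
    and "measure (barenblatt_measure p M t) {x. \<bar>x\<bar> > R} = M - measure (barenblatt_measure p M t) {x. \<bar>x\<bar> \<le> R}"
    and "R > 0 \<Longrightarrow> M - tail_coefficient p t / ((p - 1) / (2 - p)) * R powr (- (2 * ((p - 1) / (2 - p))))
          \<le> measure (barenblatt_measure p M t) {x. \<bar>x\<bar> \<le> R}"
    and "R > 0 \<Longrightarrow> measure (barenblatt_measure p M t) {x. \<bar>x\<bar> \<le> R}
          \<le> max (2 * tail_coefficient p t * R powr (- (2 * ((p - 1) / (2 - p)))))
              (M - 2 powr (- ((p - 1) / (2 - p))) *
                (tail_coefficient p t / ((p - 1) / (2 - p)) * R powr (- (2 * ((p - 1) / (2 - p))))))"
proof -
  let ?B = "\<lambda>x. barenblatt p M x t" and ?\<mu> = "barenblatt_measure p M t"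
  obtain \<rho> where \<rho>: "\<rho> > 0" and form: "\<And>x. ?B x
    = tail_coefficient p t * (\<rho> + \<bar>x\<bar> powr (p / (p - 1))) powr (- ((p - 1) / (2 - p)))"
    using barenblatt_algebraic_form[OF assms] by blast
  note A = tail_coefficient_pos[OF assms(1,2,4)]
  have nonneg: "?B x \<ge> 0" for x
    using A by (simp add: form)
  have mass: "has_bochner_integral lborel ?B M"
    using barenblatt_constant_spec(2)[OF assms] .
  then have int: "integrable lborel ?B" and total: "(\<integral>x. ?B x \<partial>lborel) = M"
    by (auto simp: has_bochner_integral_iff)
  show sets: "sets ?\<mu> = sets borel" by (simp add: barenblatt_measure_def)
  have space: "space ?\<mu> = UNIV" by (simp add: barenblatt_measure_def)
  have "emeasure ?\<mu> (space ?\<mu>) = (\<integral>\<^sup>+x. ennreal (?B x) \<partial>lborel)"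
    using int unfolding space unfolding barenblatt_measure_def by (subst emeasure_density) auto
  also have "\<dots> = ennreal M"
    using nn_integral_eq_integral[OF int] nonneg total by simp
  finally have em: "emeasure ?\<mu> (space ?\<mu>) = ennreal M" .
  then show fin: "finite_measure ?\<mu>" by (intro finite_measureI) simp
  interpret finite_measure ?\<mu> by (rule fin)
  have "measure ?\<mu> (space ?\<mu>) = M" using em assms by (simp add: measure_def)
  moreover have "{x. \<bar>x\<bar> > R} = space ?\<mu> - {x. \<bar>x\<bar> \<le> R}" by (auto simp: space)
  moreover have "{x::real. \<bar>x\<bar> \<le> R} \<in> sets ?\<mu>" unfolding sets by simp
  ultimately show "measure ?\<mu> {x. \<bar>x\<bar> > R} = M - measure ?\<mu> {x. \<bar>x\<bar> \<le> R}"
    using finite_measure_compl by metis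
  have inside: "measure ?\<mu> {x. \<bar>x\<bar> \<le> R} = (\<integral>x. indicator {x. \<bar>x\<bar> \<le> R} x * ?B x \<partial>lborel)"
    unfolding barenblatt_measure_def by (intro measure_density_real int nonneg) simp
  have q: "p / (p - 1) * ((p - 1) / (2 - p)) = 1 + 2 * ((p - 1) / (2 - p))"
  proof -
    have "p / (p - 1) * ((p - 1) / (2 - p)) = p / (2 - p)" using assms by simp
    also have "\<dots> = 1 + 2 * ((p - 1) / (2 - p))" using assms by (simp add: field_simps)
    finally show ?thesis .
  qed
  note bounds = inside_mass_bounds[OF form mass A \<rho> _ _ _ q, of R, folded inside]
  show "R > 0 \<Longrightarrow> M - tail_coefficient p t / ((p - 1) / (2 - p)) * R powr (- (2 * ((p - 1) / (2 - p))))
          \<le> measure ?\<mu> {x. \<bar>x\<bar> \<le> R}"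
    using bounds(1) assms by simp
  show "R > 0 \<Longrightarrow> measure ?\<mu> {x. \<bar>x\<bar> \<le> R}
          \<le> max (2 * tail_coefficient p t * R powr (- (2 * ((p - 1) / (2 - p)))))
              (M - 2 powr (- ((p - 1) / (2 - p))) *
                (tail_coefficient p t / ((p - 1) / (2 - p)) * R powr (- (2 * ((p - 1) / (2 - p))))))"
    using bounds(2) assms by simp
qed

lemma eventually_exponent_range: "\<forall>\<^sub>F p in at_right 1. 1 < p \<and> p < (2::real)"
  by (simp add: eventually_at_right[of 1 "2::real"] exI[of _ 2])

text \<open>The limit of the upper bound is \<open>max 0 (M - 2 t)\<close>: the first branch is
  \<open>O(tail_coefficient p t)\<close> and vanishes, the second converges because
  \<open>tail_coefficient p t / g \<rightarrow> 2 t\<close> and \<open>R powr (- 2 g)\<close>, \<open>2 powr (- g)\<close> tend to \<open>1\<close>.\<close>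

lemma inside_mass_tendsto:
  fixes M t R :: real
  assumes "M > 0" "t > 0" "R > 0"
  shows "((\<lambda>p. measure (barenblatt_measure p M t) {x. \<bar>x\<bar> \<le> R}) \<longlongrightarrow> max (M - 2 * t) 0) (at_right 1)"
proof -
  define L where "L p = tail_coefficient p t / ((p - 1) / (2 - p)) * R powr (- (2 * ((p - 1) / (2 - p))))" for p
  define U where "U p = max (2 * tail_coefficient p t * R powr (- (2 * ((p - 1) / (2 - p)))))
              (M - 2 powr (- ((p - 1) / (2 - p))) * L p)" for p
  have g: "((\<lambda>p. tail_coefficient p t / ((p - 1) / (2 - p))) \<longlongrightarrow> 2 * t) (at_right 1)"
    unfolding tail_coefficient_def using assms by real_asymp
  have A: "((\<lambda>p. tail_coefficient p t) \<longlongrightarrow> 0) (at_right 1)"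
    unfolding tail_coefficient_def using assms by real_asymp
  have R: "((\<lambda>p. R powr (- (2 * ((p - 1) / (2 - p))))) \<longlongrightarrow> 1) (at_right 1)"
    using assms by real_asymp
  have two: "((\<lambda>p::real. 2 powr (- ((p - 1) / (2 - p)))) \<longlongrightarrow> (1::real)) (at_right 1)"
    by real_asymp
  have L: "(L \<longlongrightarrow> 2 * t) (at_right 1)"
    unfolding L_def using tendsto_mult[OF g R] by simp
  have lower: "((\<lambda>p. max (M - L p) 0) \<longlongrightarrow> max (M - 2 * t) 0) (at_right 1)"
    by (intro tendsto_intros L)
  have "(U \<longlongrightarrow> max (2 * 0 * 1) (M - 1 * (2 * t))) (at_right 1)"
    unfolding U_def by (intro tendsto_intros L A R two)
  then have upper: "(U \<longlongrightarrow> max (M - 2 * t) 0) (at_right 1)"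
    by (simp add: max.commute)
  show ?thesis
  proof (rule tendsto_sandwich[OF _ _ lower upper])
    show "\<forall>\<^sub>F p in at_right 1. max (M - L p) 0 \<le> measure (barenblatt_measure p M t) {x. \<bar>x\<bar> \<le> R}"
      using eventually_exponent_range
      by eventually_elim (use barenblatt_measure_facts(4) assms in \<open>auto simp: L_def\<close>)
    show "\<forall>\<^sub>F p in at_right 1. measure (barenblatt_measure p M t) {x. \<bar>x\<bar> \<le> R} \<le> U p"
      using eventually_exponent_range
      by eventually_elim (use barenblatt_measure_facts(5) assms in \<open>auto simp: U_def L_def\<close>)
  qed
qed

section \<open>Vague convergence to a multiple of the Dirac mass\<close>

lemma integral_scaled_dirac:
  fixes \<phi> :: "real \<Rightarrow> real"
  assumes "m \<ge> 0" "\<phi> \<in> borel_measurable borel"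
  shows "(\<integral>x. \<phi> x \<partial>(scale_measure (ennreal m) (return borel 0))) = m * \<phi> 0"
proof -
  have "scale_measure (ennreal m) (return borel (0::real)) = density (return borel 0) (\<lambda>_. ennreal m)"
    by (rule measure_eqI) (auto simp: emeasure_density nn_integral_cmult_indicator)
  then show ?thesis
    using assms by (simp add: integral_density integral_return)
qed

text \<open>If all balls have the same limiting mass, the annuli between two of them lose their mass in
  the limit. A test function then sees only a small ball, where it is nearly \<open>\<phi> 0\<close>, and an
  annulus up to the edge of its support, which does not contribute.\<close>

lemma vague_tendsto_dirac:
  fixes \<mu> :: "'i \<Rightarrow> real measure" and m :: real
  assumes fin: "\<forall>\<^sub>F i in F. finite_measure (\<mu> i) \<and> sets (\<mu> i) = sets borel"
    and m: "m \<ge> 0"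
    and balls: "\<And>R. R > 0 \<Longrightarrow> ((\<lambda>i. measure (\<mu> i) {x. \<bar>x\<bar> \<le> R}) \<longlongrightarrow> m) F"
  shows "vague_tendsto \<mu> (scale_measure (ennreal m) (return borel 0)) F"
  unfolding vague_tendsto_def
proof (intro allI impI, elim conjE)
  fix \<phi> :: "real \<Rightarrow> real"
  assume cont: "continuous_on UNIV \<phi>" and comp: "compact (closure {x. \<phi> x \<noteq> 0})"
  have meas[measurable]: "\<phi> \<in> borel_measurable borel"
    using cont by (rule borel_measurable_continuous_onI)
  obtain S where S: "\<And>x. \<phi> x \<noteq> 0 \<Longrightarrow> \<bar>x\<bar> \<le> S"
    using compact_imp_bounded[OF comp] closure_subset[of "{x. \<phi> x \<noteq> 0}"]
    unfolding bounded_iff by (auto simp: subset_iff)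
  have "compact (\<phi> ` closure {x. \<phi> x \<noteq> 0})"
    by (rule compact_continuous_image[OF continuous_on_subset[OF cont] comp]) simp
  then have "bounded (\<phi> ` closure {x. \<phi> x \<noteq> 0})" by (rule compact_imp_bounded)
  then obtain K0 where K0: "\<And>x. x \<in> closure {x. \<phi> x \<noteq> 0} \<Longrightarrow> \<bar>\<phi> x\<bar> \<le> K0"
    unfolding bounded_iff by auto
  define K where "K = max K0 0"
  have K: "\<bar>\<phi> x\<bar> \<le> K" for x
    using K0[of x] closure_subset[of "{x. \<phi> x \<noteq> 0}"] by (cases "\<phi> x = 0") (auto simp: K_def subset_iff max_def)
  have "((\<lambda>i. \<integral>x. \<phi> x \<partial>\<mu> i) \<longlongrightarrow> m * \<phi> 0) F"
  proof (rule tendstoI)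
    fix e :: real assume e: "e > 0"
    \<comment> \<open>The error has limit \<open>d * m\<close>, which must be below \<open>e\<close> also when \<open>m = 0\<close>.\<close>
    define d where "d = e / (m + 1)"
    have d: "d > 0" "d * m < e" using e m by (auto simp: d_def field_simps)
    have "isCont \<phi> 0" using cont by (simp add: continuous_on_eq_continuous_at)
    then obtain r where r: "r > 0" "\<And>x. \<bar>x\<bar> < r \<Longrightarrow> \<bar>\<phi> x - \<phi> 0\<bar> < d"
      using d(1) unfolding continuous_at_eps_delta by (auto simp: dist_real_def)
    define R where "R = r / 2"
    define T where "T = max S R"
    have R: "R > 0" "\<And>x. \<bar>x\<bar> \<le> R \<Longrightarrow> \<bar>\<phi> x - \<phi> 0\<bar> \<le> d" and T: "T > 0" "R \<le> T" "S \<le> T"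
      using r by (auto simp: R_def T_def less_imp_le)
    let ?mass = "\<lambda>r i. measure (\<mu> i) {x. \<bar>x\<bar> \<le> r}"
    let ?err = "\<lambda>i. d * ?mass R i + K * (?mass T i - ?mass R i) + \<bar>\<phi> 0\<bar> * \<bar>?mass R i - m\<bar>"
    have "(?err \<longlongrightarrow> d * m + K * (m - m) + \<bar>\<phi> 0\<bar> * \<bar>m - m\<bar>) F"
      by (intro tendsto_intros balls R T)
    then have small: "\<forall>\<^sub>F i in F. ?err i < e"
      using d(2) by (intro order_tendstoD) auto
    show "\<forall>\<^sub>F i in F. dist (\<integral>x. \<phi> x \<partial>\<mu> i) (m * \<phi> 0) < e"
      using fin small
    proof eventually_elim
      case (elim i)
      then interpret finite_measure "\<mu> i" by simp
      have sets[measurable_cong]: "sets (\<mu> i) = sets borel" using elim by simp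
      have space: "space (\<mu> i) = UNIV" using sets_eq_imp_space_eq[OF sets] by simp
      let ?\<chi> = "\<lambda>r. indicat_real {x. \<bar>x\<bar> \<le> r}"
      have int_\<phi>: "integrable (\<mu> i) \<phi>"
        using K by (intro integrable_const_bound[of _ K]) auto
      have int_\<chi>: "integrable (\<mu> i) (?\<chi> r)" and mass_\<chi>: "(\<integral>x. ?\<chi> r x \<partial>\<mu> i) = ?mass r i" for r
        by (auto simp: space emeasure_eq_measure)
      have "\<bar>(\<integral>x. \<phi> x \<partial>\<mu> i) - \<phi> 0 * ?mass R i\<bar> = \<bar>\<integral>x. (\<phi> x - \<phi> 0 * ?\<chi> R x) \<partial>\<mu> i\<bar>"
        using int_\<phi> int_\<chi> mass_\<chi> by simp
      also have "\<dots> \<le> (\<integral>x. (d * ?\<chi> R x + K * (?\<chi> T x - ?\<chi> R x)) \<partial>\<mu> i)"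
      proof (rule integral_abs_bound[THEN order_trans], rule integral_mono)
        fix x
        show "\<bar>\<phi> x - \<phi> 0 * ?\<chi> R x\<bar> \<le> d * ?\<chi> R x + K * (?\<chi> T x - ?\<chi> R x)"
          using R(2)[of x] K[of x] S[of x] T by (cases "\<phi> x = 0") (auto simp: indicator_def)
      qed (use int_\<phi> int_\<chi> in auto)
      also have "\<dots> = d * ?mass R i + K * (?mass T i - ?mass R i)"
        using int_\<chi> mass_\<chi> by simp
      finally have 1: "\<bar>(\<integral>x. \<phi> x \<partial>\<mu> i) - \<phi> 0 * ?mass R i\<bar> \<le> d * ?mass R i + K * (?mass T i - ?mass R i)" .
      have "\<bar>\<phi> 0 * ?mass R i - m * \<phi> 0\<bar> = \<bar>\<phi> 0\<bar> * \<bar>?mass R i - m\<bar>"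
        by (simp add: abs_mult[symmetric] algebra_simps)
      with 1 elim show ?case unfolding dist_real_def by linarith
    qed
  qed
  then show "((\<lambda>i. \<integral>x. \<phi> x \<partial>\<mu> i) \<longlongrightarrow> (\<integral>x. \<phi> x \<partial>scale_measure (ennreal m) (return borel 0))) F"
    using m by (simp add: integral_scaled_dirac meas)
qed

text \<open>Vague limits are unique, and a single test function with \<open>\<phi> 0 = 1\<close>, the tent function,
  separates a nonzero multiple of the Dirac mass from the null measure.\<close>

lemma vague_limit_dirac_null_iff:
  fixes \<mu> :: "'i \<Rightarrow> real measure" and m :: real
  assumes lim: "vague_tendsto \<mu> (scale_measure (ennreal m) (return borel 0)) F"
    and m: "m \<ge> 0" and F: "F \<noteq> bot"
  shows "vague_tendsto \<mu> (null_measure borel) F \<longleftrightarrow> m = 0"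
proof
  assume "m = 0"
  with lim show "vague_tendsto \<mu> (null_measure borel) F"
    by (simp add: vague_tendsto_def)
next
  assume null: "vague_tendsto \<mu> (null_measure borel) F"
  define \<phi> where "\<phi> x = max 0 (1 - \<bar>x\<bar>)" for x :: real
  have cont: "continuous_on UNIV \<phi>" unfolding \<phi>_def by (intro continuous_intros)
  have "bounded {x. \<phi> x \<noteq> 0}"
    by (rule bounded_subset[of "cball 0 1"]) (auto simp: \<phi>_def)
  then have comp: "compact (closure {x. \<phi> x \<noteq> 0})" by simp
  have "((\<lambda>i. \<integral>x. \<phi> x \<partial>\<mu> i) \<longlongrightarrow> m * \<phi> 0) F"
    using lim cont comp m borel_measurable_continuous_onI[OF cont]
    by (auto simp: vague_tendsto_def integral_scaled_dirac)
  moreover have "((\<lambda>i. \<integral>x. \<phi> x \<partial>\<mu> i) \<longlongrightarrow> 0) F"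
    using null cont comp by (auto simp: vague_tendsto_def)
  ultimately have "m * \<phi> 0 = 0" using tendsto_unique[OF F] by blast
  then show "m = 0" by (simp add: \<phi>_def)
qed

section \<open>The singular limit\<close>

theorem theorem9p2:
  "(\<forall>M>0. \<forall>t>0.
      vague_tendsto (\<lambda>p. barenblatt_measure p M t)
        (scale_measure (ennreal (max (M - 2 * t) 0)) (return borel 0)) (at_right 1) \<and>
      (\<forall>R>0.
        ((\<lambda>p. measure (barenblatt_measure p M t) {x. \<bar>x\<bar> \<le> R}) \<longlongrightarrow> max (M - 2 * t) 0) (at_right 1) \<and>
        ((\<lambda>p. measure (barenblatt_measure p M t) {x. \<bar>x\<bar> > R}) \<longlongrightarrow> M - max (M - 2 * t) 0) (at_right 1)) \<and>
      (vague_tendsto (\<lambda>p. barenblatt_measure p M t) (null_measure borel) (at_right 1)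
        \<longleftrightarrow> t \<ge> M / 2)) \<and>
   (\<forall>\<^sub>F p in at_right 1. \<forall>M>0. \<forall>t>0. \<forall>x. x \<noteq> 0 \<longrightarrow>
      barenblatt p M x t
        \<le> (2 * (p - 1) * (p / (2 - p)) powr (p - 1) * t / \<bar>x\<bar> powr p) powr (1 / (2 - p))) \<and>
   ((\<lambda>p. (p / (2 - p)) powr (p - 1)) \<longlongrightarrow> (1::real)) (at_right 1)"
proof (intro conjI allI impI)
  fix M t :: real assume Mt: "M > 0" "t > 0"
  let ?m = "max (M - 2 * t) 0" and ?\<mu> = "\<lambda>p. barenblatt_measure p M t"
  have inside: "((\<lambda>p. measure (?\<mu> p) {x. \<bar>x\<bar> \<le> R}) \<longlongrightarrow> ?m) (at_right 1)" if "R > 0" for R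
    using inside_mass_tendsto[OF Mt that] .
  show vague: "vague_tendsto ?\<mu> (scale_measure (ennreal ?m) (return borel 0)) (at_right 1)"
  proof (rule vague_tendsto_dirac)
    show "\<forall>\<^sub>F p in at_right 1. finite_measure (?\<mu> p) \<and> sets (?\<mu> p) = sets borel"
      using eventually_exponent_range
      by eventually_elim (use barenblatt_measure_facts(1,2) Mt in auto)
  qed (use inside in auto)
  show "vague_tendsto ?\<mu> (null_measure borel) (at_right 1) \<longleftrightarrow> t \<ge> M / 2"
    using vague_limit_dirac_null_iff[OF vague] by auto
  fix R :: real assume R: "R > 0"
  show "((\<lambda>p. measure (?\<mu> p) {x. \<bar>x\<bar> \<le> R}) \<longlongrightarrow> ?m) (at_right 1)"
    by (rule inside[OF R])
  have "((\<lambda>p. M - measure (?\<mu> p) {x. \<bar>x\<bar> \<le> R}) \<longlongrightarrow> M - ?m) (at_right 1)"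
    by (intro tendsto_intros inside R)
  moreover have "\<forall>\<^sub>F p in at_right 1. M - measure (?\<mu> p) {x. \<bar>x\<bar> \<le> R} = measure (?\<mu> p) {x. \<bar>x\<bar> > R}"
    using eventually_exponent_range
    by eventually_elim (use barenblatt_measure_facts(3) Mt in auto)
  ultimately show "((\<lambda>p. measure (?\<mu> p) {x. \<bar>x\<bar> > R}) \<longlongrightarrow> M - ?m) (at_right 1)"
    by (rule Lim_transform_eventually)
next
  show "\<forall>\<^sub>F p in at_right 1. \<forall>M>0. \<forall>t>0. \<forall>x. x \<noteq> 0 \<longrightarrow>
      barenblatt p M x t
        \<le> (2 * (p - 1) * (p / (2 - p)) powr (p - 1) * t / \<bar>x\<bar> powr p) powr (1 / (2 - p))"
    using eventually_exponent_range by eventually_elim (use barenblatt_upper_bound in blast)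
next
  show "((\<lambda>p. (p / (2 - p)) powr (p - 1)) \<longlongrightarrow> (1::real)) (at_right 1)"
    by real_asymp
qed

end
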